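(* Let $K\ge 1$ be an integer, $Q>0$, and let $T>1$ be the total storage capacity. In the wireless cloud storage model described in the context, the maximal symmetric allocation $\mathbf{a}_{\mathrm{sym}}=(T/K,\ldots,T/K)$ is optimal in terms of the exponential order of the recovery failure probability: for every storage allocation $\mathbf{a}=(a_1,\ldots,a_K)$ with $a_i\ge 0$ for all $i$ and $\sum_{i=1}^K a_i\le T$, one has $d(\mathbf{a})\le d(\mathbf{a}_{\mathrm{sym}})$.
   Context: Model. There are $K$ storage nodes $1,\ldots,K$, a source $s$ and a data collector $c$. The channel gains $h_{s,1},\ldots,h_{s,K},h_{1,c},\ldots,h_{K,c}$ are i.i.d. circularly symmetric complex Gaussian with zero mean and unit variance (so the $|h|^2$ are i.i.d. exponential with mean 1). $\rho>0$ is the SNR, $Q>0$ is a fixed rate threshold, and a storage allocation is a vector $\mathbf{a}=(a_1,\ldots,a_K)$ with $a_i\ge 0$ ($a_i$ is the amount of MDS-coded data stored at node $i$; the data object has size 1). Storage phase: the (random) decoding set is $\mathcal{D}=\{i: \log_2(1+\rho|h_{s,i}|^2)\ge Q\}$. Recovery phase: if $\sum_{i\in\mathcal{D}}a_i<1$, recovery fails. If $\sum_{i\in\mathcal{D}}a_i\ge 1$, the collector, knowing the channel gains, chooses time fractions $(t_i)_{i\in\mathcal{D}}$ maximizing $\sum_{i\in\mathcal{D}}t_i\log_2(1+\rho|h_{i,c}|^2)$ subject to $0\le t_i\le a_i$ and $\sum_{i\in\mathcal{D}}t_i=1$; recovery succeeds if this maximum is $>Q$ and fails otherwise. The recovery failure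 probability is $\mathrm{Pr}_f(\mathbf{a},\rho)$, the probability that recovery fails. The exponential order of the recovery failure probability is $$d(\mathbf{a})=-\lim_{\rho\to\infty}\frac{\log \mathrm{Pr}_f(\mathbf{a},\rho)}{\log\rho}.$$ *)

theory Defs
  imports "HOL-Probability.Probability"
begin

text \<open>
  Density of a circularly symmetric complex Gaussian with zero mean and unit variance:
  real and imaginary part are independent, each normal with mean 0 and variance 1/2.
\<close>
definition std_complex_gaussian_density :: "complex \<Rightarrow> real" where
  "std_complex_gaussian_density z = exp (- (cmod z)\<^sup>2) / pi"

text \<open>
  The gains from the source to node \<open>i\<close> (\<open>hs i\<close>) and from node \<open>i\<close> to the collector (\<open>hc i\<close>),
  for \<open>i \<in> {1..K}\<close>; independence is joint over all \<open>2 * K\<close> gains, indexed by the disjoint sum.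
\<close>
definition iid_rayleigh_gains ::
    "'w measure \<Rightarrow> nat \<Rightarrow> (nat \<Rightarrow> 'w \<Rightarrow> complex) \<Rightarrow> (nat \<Rightarrow> 'w \<Rightarrow> complex) \<Rightarrow> bool" where
  "iid_rayleigh_gains M K hs hc \<longleftrightarrow>
     prob_space.indep_vars M (\<lambda>_. borel) (case_sum hs hc) ({1..K} <+> {1..K}) \<and>
     (\<forall>j \<in> {1..K} <+> {1..K}.
        distributed M lborel (case_sum hs hc j) (\<lambda>z. ennreal (std_complex_gaussian_density z)))"

definition link_rate :: "real \<Rightarrow> complex \<Rightarrow> real" where
  "link_rate \<rho> h = log 2 (1 + \<rho> * (cmod h)\<^sup>2)"

definition decoding_set :: "nat \<Rightarrow> real \<Rightarrow> real \<Rightarrow> (nat \<Rightarrow> complex) \<Rightarrow> nat set" where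
  "decoding_set K Q \<rho> gs = {i \<in> {1..K}. link_rate \<rho> (gs i) \<ge> Q}"

definition time_fractions :: "(nat \<Rightarrow> real) \<Rightarrow> nat set \<Rightarrow> (nat \<Rightarrow> real) set" where
  "time_fractions a D = {t. (\<forall>i\<in>D. 0 \<le> t i \<and> t i \<le> a i) \<and> (\<Sum>i\<in>D. t i) = 1}"

text \<open>
  The supremum is a maximum whenever \<open>D\<close> is finite, \<open>a \<ge> 0\<close> on \<open>D\<close> and \<open>(\<Sum>i\<in>D. a i) \<ge> 1\<close>: restricted
  to \<open>D\<close>, the admissible time fractions then form a nonempty compact set. It is only used there.
\<close>
definition max_recovery_rate ::
    "(nat \<Rightarrow> real) \<Rightarrow> real \<Rightarrow> nat set \<Rightarrow> (nat \<Rightarrow> complex) \<Rightarrow> real" where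
  "max_recovery_rate a \<rho> D gc = (SUP t \<in> time_fractions a D. \<Sum>i\<in>D. t i * link_rate \<rho> (gc i))"

definition recovery_succeeds ::
    "nat \<Rightarrow> real \<Rightarrow> (nat \<Rightarrow> real) \<Rightarrow> real \<Rightarrow> (nat \<Rightarrow> complex) \<Rightarrow> (nat \<Rightarrow> complex) \<Rightarrow> bool" where
  "recovery_succeeds K Q a \<rho> gs gc \<longleftrightarrow>
     (let D = decoding_set K Q \<rho> gs
      in (\<Sum>i\<in>D. a i) \<ge> 1 \<and> max_recovery_rate a \<rho> D gc > Q)"

definition failure_prob ::
    "'w measure \<Rightarrow> (nat \<Rightarrow> 'w \<Rightarrow> complex) \<Rightarrow> (nat \<Rightarrow> 'w \<Rightarrow> complex) \<Rightarrow>
     nat \<Rightarrow> real \<Rightarrow> (nat \<Rightarrow> real) \<Rightarrow> real \<Rightarrow> real" where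
  "failure_prob M hs hc K Q a \<rho> =
     measure M {\<omega> \<in> space M. \<not> recovery_succeeds K Q a \<rho> (\<lambda>i. hs i \<omega>) (\<lambda>i. hc i \<omega>)}"

text \<open>
  \<^const>\<open>Lim\<close> is meaningful only if the limit exists; existence has to be stated separately.
\<close>
definition failure_order ::
    "'w measure \<Rightarrow> (nat \<Rightarrow> 'w \<Rightarrow> complex) \<Rightarrow> (nat \<Rightarrow> 'w \<Rightarrow> complex) \<Rightarrow>
     nat \<Rightarrow> real \<Rightarrow> (nat \<Rightarrow> real) \<Rightarrow> real" where
  "failure_order M hs hc K Q a =
     - Lim at_top (\<lambda>\<rho>. ln (failure_prob M hs hc K Q a \<rho>) / ln \<rho>)"

text \<open>Only the values of an allocation on \<open>{1..K}\<close> matter.\<close>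
definition storage_allocations :: "nat \<Rightarrow> real \<Rightarrow> (nat \<Rightarrow> real) set" where
  "storage_allocations K T = {a. (\<forall>i\<in>{1..K}. a i \<ge> 0) \<and> (\<Sum>i=1..K. a i) \<le> T}"

definition max_symmetric_allocation :: "nat \<Rightarrow> real \<Rightarrow> nat \<Rightarrow> real" where
  "max_symmetric_allocation K T = (\<lambda>_. T / real K)"

end

theory Submission
  imports Defs
begin

text \<open>
  A link has rate below a fixed threshold with probability of order \<open>1 / \<rho>\<close>. Let \<open>d\<close> be the least
  number of nodes whose loss leaves less than one unit of stored data. Losing such nodes in the
  storage phase makes recovery fail, with probability of order \<open>\<rho> ^ - d\<close>. Conversely, if recovery
  fails although \<open>sum a D \<ge> 1\<close>, the time fractions proportional to \<open>a\<close> show that every node of \<open>D\<close>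
  with \<open>a i > 0\<close> has a collector link of bounded rate; since losing all nodes with \<open>a i > 0\<close> leaves
  nothing, at least \<open>d\<close> of the independent \<open>2 * K\<close> links have bounded rate in every failure. So the
  order of failure is exactly \<open>d\<close>. By averaging, the \<open>m\<close> least loaded nodes of an allocation hold
  at most \<open>m * T / K\<close> data, which is what any \<open>m\<close> nodes hold in the symmetric allocation, so \<open>d\<close> is
  largest for the latter.
\<close>

section \<open>Combinatorics of allocations: averaging and the loss exponent\<close>

text \<open>Starting from \<open>A\<close>, removing a largest element never raises the average of
  what remains. Denominators are cleared, so empty sets cause no division by zero.\<close>

lemma exists_subset_sum_le_average:
  fixes f :: "'a \<Rightarrow> real"
  assumes "finite A" and "m \<le> card A"
  shows "\<exists>B\<subseteq>A. card B = m \<and> real (card A) * sum f B \<le> real m * sum f A"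
  using assms(2)
proof (induction rule: inc_induct)
  case base
  then show ?case by (intro exI[of _ A]) auto
next
  case (step n)
  then obtain B where B: "B \<subseteq> A" "card B = Suc n"
      "real (card A) * sum f B \<le> real (Suc n) * sum f A"
    by blast
  have fin: "finite B" and ne: "B \<noteq> {}"
    using B assms(1) finite_subset by auto
  have "Max (f ` B) \<in> f ` B" using fin ne by simp
  then obtain x where x: "x \<in> B" "f x = Max (f ` B)" by auto
  \<comment> \<open>A maximum is at least the average over \<open>B\<close>; hence dropping
    \<open>x\<close> does not raise that average.\<close>
  have "sum f B \<le> real (card B) * f x"
    using fin x by (intro sum_bounded_above) auto
  then have "real (Suc n) * sum f (B - {x}) \<le> real n * sum f B"
    using B x fin by (simp add: sum_diff1 algebra_simps)
  then have "real (card A) * (real (Suc n) * sum f (B - {x})) \<le> real (card A) * (real n * sum f B)"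
    by (intro mult_left_mono) auto
  also have "\<dots> = real n * (real (card A) * sum f B)" by simp
  also have "\<dots> \<le> real n * (real (Suc n) * sum f A)"
    using B by (intro mult_left_mono) auto
  finally have "real (Suc n) * (real (card A) * sum f (B - {x})) \<le> real (Suc n) * (real n * sum f A)"
    by (simp only: mult.left_commute)
  then have "real (card A) * sum f (B - {x}) \<le> real n * sum f A"
    by (subst (asm) mult_le_cancel_left_pos) auto
  then show ?case
    using B x fin by (intro exI[of _ "B - {x}"]) auto
qed

text \<open>The number \<open>d\<close> of the overview. The minimum is over a nonempty set, since
  \<open>S = {1..K}\<close> leaves the empty sum 0.\<close>

definition loss_exponent :: "nat \<Rightarrow> (nat \<Rightarrow> real) \<Rightarrow> nat" where
  "loss_exponent K a = Min (card ` {S. S \<subseteq> {1..K} \<and> sum a ({1..K} - S) < 1})"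

lemma loss_exponent_le:
  assumes "S \<subseteq> {1..K}" and "sum a ({1..K} - S) < 1"
  shows "loss_exponent K a \<le> card S"
  unfolding loss_exponent_def using assms by (intro Min_le) auto

lemma loss_exponent_attained:
  obtains S where "S \<subseteq> {1..K}" "sum a ({1..K} - S) < 1" "card S = loss_exponent K a"
proof -
  have "{1..K} \<in> {S. S \<subseteq> {1..K} \<and> sum a ({1..K} - S) < 1}" by simp
  then have "loss_exponent K a \<in> card ` {S. S \<subseteq> {1..K} \<and> sum a ({1..K} - S) < 1}"
    unfolding loss_exponent_def by (intro Min_in finite_imageI) auto
  then show ?thesis using that by auto
qed

lemma max_symmetric_allocation_in:
  assumes "K \<ge> 1" and "T \<ge> 0"
  shows "max_symmetric_allocation K T \<in> storage_allocations K T"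
  using assms by (simp add: max_symmetric_allocation_def storage_allocations_def)

text \<open>In the symmetric allocation only the number \<open>m\<close> of survivors counts. If
  they hold \<open>m * T / K < 1\<close>, then by averaging some \<open>m\<close> nodes of
  \<open>a\<close> hold less than 1 as well, and losing the other \<open>K - m\<close> nodes is
  fatal for \<open>a\<close>.\<close>

lemma loss_exponent_le_symmetric:
  assumes K: "K \<ge> 1" and a: "a \<in> storage_allocations K T"
  shows "loss_exponent K a \<le> loss_exponent K (max_symmetric_allocation K T)"
proof -
  obtain S where S: "S \<subseteq> {1..K}" "sum (max_symmetric_allocation K T) ({1..K} - S) < 1"
      "card S = loss_exponent K (max_symmetric_allocation K T)"
    by (rule loss_exponent_attained)
  define m where "m = card ({1..K} - S)"
  have fin: "finite S" using S(1) finite_subset by blast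
  have m: "m = K - card S" "card S \<le> K"
    using S(1) card_mono[OF _ S(1)] by (auto simp: m_def card_Diff_subset fin)
  have lt: "real m * T < K"
    using S(2) K unfolding max_symmetric_allocation_def m_def by (simp add: field_simps)
  obtain B where B: "B \<subseteq> {1..K}" "card B = m" "real K * sum a B \<le> real m * sum a {1..K}"
    using exists_subset_sum_le_average[of "{1..K}" m a] m by auto
  have "real m * sum a {1..K} \<le> real m * T"
    using a by (intro mult_left_mono) (auto simp: storage_allocations_def)
  then have "real K * sum a B < real K * 1" using B(3) lt by simp
  then have "sum a B < 1" using K by (subst (asm) mult_less_cancel_left_pos) auto
  then have "loss_exponent K a \<le> card ({1..K} - B)"
    using B(1) by (intro loss_exponent_le) (auto simp: double_diff)
  also have "\<dots> = card S"
    using B m by (subst card_Diff_subset) (auto intro: finite_subset)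
  finally show ?thesis using S(3) by simp
qed

section \<open>Asymptotics on the logarithmic scale\<close>

text \<open>Constant factors contribute only \<open>ln C / ln \<rho>\<close>, which vanishes in the
  limit.\<close>

lemma tendsto_ln_ratio_powr_bounds:
  fixes p :: "real \<Rightarrow> real"
  assumes c: "c1 > 0" "c2 > 0"
    and lower: "\<forall>\<^sub>F \<rho> in at_top. c1 * (1 / \<rho>) ^ d \<le> p \<rho>"
    and upper: "\<forall>\<^sub>F \<rho> in at_top. p \<rho> \<le> c2 * (1 / \<rho>) ^ d"
  shows "((\<lambda>\<rho>. ln (p \<rho>) / ln \<rho>) \<longlongrightarrow> - real d) at_top"
proof -
  have inv: "((\<lambda>\<rho>::real. ln C / ln \<rho> - real d) \<longlongrightarrow> - real d) at_top" for C :: real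
  proof -
    have "((\<lambda>\<rho>::real. ln C / ln \<rho>) \<longlongrightarrow> 0) at_top"
      by (rule tendsto_divide_0[OF tendsto_const])
        (rule filterlim_mono[OF ln_at_top at_top_le_at_infinity order_refl])
    from tendsto_diff[OF this tendsto_const[of "real d"]] show ?thesis by simp
  qed
  have eq: "ln (C * (1 / \<rho>) ^ d) / ln \<rho> = ln C / ln \<rho> - real d" if "C > 0" "\<rho> > 1" for C \<rho> :: real
    using that by (simp add: ln_mult ln_realpow ln_div field_simps)
  show ?thesis
  proof (rule tendsto_sandwich[OF _ _ inv[of c1] inv[of c2]])
    show "\<forall>\<^sub>F \<rho> in at_top. ln c1 / ln \<rho> - real d \<le> ln (p \<rho>) / ln \<rho>"
      using lower eventually_gt_at_top[of 1]
    proof eventually_elim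
      case (elim \<rho>)
      have "0 < c1 * (1 / \<rho>) ^ d" using c elim by simp
      then have "ln (c1 * (1 / \<rho>) ^ d) \<le> ln (p \<rho>)" using elim by (intro ln_mono) auto
      then show ?case
        using elim by (subst eq[OF c(1), symmetric]) (auto intro: divide_right_mono)
    qed
    show "\<forall>\<^sub>F \<rho> in at_top. ln (p \<rho>) / ln \<rho> \<le> ln c2 / ln \<rho> - real d"
      using lower upper eventually_gt_at_top[of 1]
    proof eventually_elim
      case (elim \<rho>)
      \<comment> \<open>The lower bound enters here too: it makes \<open>p \<rho>\<close> positive,
        which monotonicity of \<open>ln\<close> requires.\<close>
      have "0 < c1 * (1 / \<rho>) ^ d" using c elim by simp
      then have "ln (p \<rho>) \<le> ln (c2 * (1 / \<rho>) ^ d)" using elim by (intro ln_mono) auto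
      then show ?case
        using elim by (subst eq[OF c(2), symmetric]) (auto intro: divide_right_mono)
    qed
  qed
qed

section \<open>Slow links as disks in the complex plane\<close>

lemma link_rate_nonneg: "\<rho> \<ge> 0 \<Longrightarrow> link_rate \<rho> z \<ge> 0"
  unfolding link_rate_def by (intro zero_le_log_cancel_iff[THEN iffD2]) (auto intro: add_pos_nonneg)

text \<open>The disk has area proportional to \<open>1 / \<rho>\<close>, which is where the order of
  a slow link comes from. The closed disk serves the upper bound on failure.\<close>

lemma link_rate_le_iff:
  assumes "\<rho> > 0" and "q \<ge> 0"
  shows "link_rate \<rho> z \<le> q \<longleftrightarrow> z \<in> cball 0 (sqrt ((2 powr q - 1) / \<rho>))"
proof -
  have "1 + \<rho> * (cmod z)\<^sup>2 > 0" using assms by (intro add_pos_nonneg) auto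
  then have "link_rate \<rho> z \<le> q \<longleftrightarrow> 1 + \<rho> * (cmod z)\<^sup>2 \<le> 2 powr q"
    unfolding link_rate_def by (subst log_le_iff) auto
  also have "\<dots> \<longleftrightarrow> (cmod z)\<^sup>2 \<le> (2 powr q - 1) / \<rho>"
    using assms by (auto simp: field_simps)
  also have "\<dots> \<longleftrightarrow> cmod z \<le> sqrt ((2 powr q - 1) / \<rho>)"
    by (metis abs_norm_cancel real_sqrt_abs real_sqrt_le_iff)
  finally show ?thesis by simp
qed

text \<open>A node leaves the decoding set when its rate is strictly below \<open>Q\<close>, so the
  lower bound on failure uses the open disk.\<close>

lemma link_rate_less_iff:
  assumes "\<rho> > 0" and "q \<ge> 0"
  shows "link_rate \<rho> z < q \<longleftrightarrow> z \<in> ball 0 (sqrt ((2 powr q - 1) / \<rho>))"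
proof -
  have "1 + \<rho> * (cmod z)\<^sup>2 > 0" using assms by (intro add_pos_nonneg) auto
  then have "link_rate \<rho> z < q \<longleftrightarrow> 1 + \<rho> * (cmod z)\<^sup>2 < 2 powr q"
    unfolding link_rate_def by (subst log_less_iff) auto
  also have "\<dots> \<longleftrightarrow> (cmod z)\<^sup>2 < (2 powr q - 1) / \<rho>"
    using assms by (auto simp: field_simps)
  also have "\<dots> \<longleftrightarrow> cmod z < sqrt ((2 powr q - 1) / \<rho>)"
    by (metis abs_norm_cancel real_sqrt_abs real_sqrt_less_iff)
  finally show ?thesis by simp
qed

lemma continuous_on_link_rate:
  assumes "\<rho> \<ge> 0" and "continuous_on A g"
  shows "continuous_on A (\<lambda>x. link_rate \<rho> (g x))"
proof -
  have "1 + \<rho> * (cmod z)\<^sup>2 \<noteq> 0" for z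
    using add_pos_nonneg[of 1 "\<rho> * (cmod z)\<^sup>2"] assms(1) by simp
  then show ?thesis unfolding link_rate_def log_def
    by (intro continuous_intros assms) auto
qed


section \<open>Probability that given links are slow\<close>

locale rayleigh_gains = prob_space M for M :: "'w measure" +
  fixes K :: nat and hs hc :: "nat \<Rightarrow> 'w \<Rightarrow> complex"
  assumes iid: "iid_rayleigh_gains M K hs hc"
begin

abbreviation gain :: "nat + nat \<Rightarrow> 'w \<Rightarrow> complex" where
  "gain \<equiv> case_sum hs hc"

abbreviation links :: "(nat + nat) set" where
  "links \<equiv> {1..K} <+> {1..K}"

lemma gain_distributed:
  "j \<in> links \<Longrightarrow> distributed M lborel (gain j) (\<lambda>z. ennreal (std_complex_gaussian_density z))"
  using iid unfolding iid_rayleigh_gains_def by blast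

lemma gain_measurable: "j \<in> links \<Longrightarrow> gain j \<in> borel_measurable M"
  using distributed_measurable[OF gain_distributed] by simp

lemma hs_measurable: "i \<in> {1..K} \<Longrightarrow> hs i \<in> borel_measurable M"
  using gain_measurable[OF InlI] by simp

lemma hc_measurable: "i \<in> {1..K} \<Longrightarrow> hc i \<in> borel_measurable M"
  using gain_measurable[OF InrI] by simp

text \<open>The density is at most \<open>1 / pi\<close>, and the disk has area
  \<open>pi * r\<^sup>2\<close>.\<close>

lemma prob_gain_cball_le:
  assumes j: "j \<in> links" and r: "r \<ge> 0"
  shows "prob (gain j -` cball 0 r \<inter> space M) \<le> r\<^sup>2"
proof -
  have "emeasure M (gain j -` cball 0 r \<inter> space M) =
      (\<integral>\<^sup>+z. ennreal (std_complex_gaussian_density z) * indicator (cball 0 r) z \<partial>lborel)"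
    by (rule distributed_emeasure[OF gain_distributed[OF j]]) simp
  also have "\<dots> \<le> (\<integral>\<^sup>+z. ennreal (1 / pi) * indicator (cball 0 r) (z :: complex) \<partial>lborel)"
    by (intro nn_integral_mono mult_right_mono ennreal_leI)
      (auto simp: std_complex_gaussian_density_def field_simps)
  also have "\<dots> = ennreal (1 / pi) * ennreal (pi * r\<^sup>2)"
    using emeasure_cball[OF r, of "0 :: complex"]
    by (subst nn_integral_cmult_indicator) (auto simp: unit_ball_vol_2)
  also have "\<dots> = ennreal (r\<^sup>2)"
    by (subst ennreal_mult[symmetric]) auto
  finally show ?thesis by (simp add: emeasure_eq_measure)
qed

text \<open>Inside the unit disk the density is at least \<open>exp (- 1) / pi\<close>; hence the
  restriction to \<open>r \<le> 1\<close>.\<close>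

lemma prob_gain_ball_ge:
  assumes j: "j \<in> links" and r: "0 \<le> r" "r \<le> 1"
  shows "exp (- 1) * r\<^sup>2 \<le> prob (gain j -` ball 0 r \<inter> space M)"
proof -
  have "ennreal (exp (- 1) * r\<^sup>2) = ennreal (exp (- 1) / pi) * ennreal (pi * r\<^sup>2)"
    by (subst ennreal_mult[symmetric]) auto
  also have "\<dots> = (\<integral>\<^sup>+z. ennreal (exp (- 1) / pi) * indicator (ball 0 r) (z :: complex) \<partial>lborel)"
    using emeasure_ball[OF r(1), of "0 :: complex"]
    by (subst nn_integral_cmult_indicator) (auto simp: unit_ball_vol_2)
  also have "\<dots> \<le> (\<integral>\<^sup>+z. ennreal (std_complex_gaussian_density z) * indicator (ball 0 r) z \<partial>lborel)"
  proof (intro nn_integral_mono)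
    fix z :: complex
    have "std_complex_gaussian_density z \<ge> exp (- 1) / pi" if "cmod z < r"
      using that r power_le_one[of "cmod z" 2]
      by (auto simp: std_complex_gaussian_density_def intro!: divide_right_mono)
    then show "ennreal (exp (- 1) / pi) * indicator (ball 0 r) z
        \<le> ennreal (std_complex_gaussian_density z) * indicator (ball 0 r) z"
      by (auto split: split_indicator intro: ennreal_leI)
  qed
  also have "\<dots> = emeasure M (gain j -` ball 0 r \<inter> space M)"
    by (rule distributed_emeasure[OF gain_distributed[OF j], symmetric]) simp
  finally show ?thesis by (simp add: emeasure_eq_measure)
qed

lemma prob_gains_in:
  assumes J: "J \<subseteq> links" and A: "A \<in> sets borel"
  shows "{\<omega> \<in> space M. \<forall>j\<in>J. gain j \<omega> \<in> A} \<in> events"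
    and "prob {\<omega> \<in> space M. \<forall>j\<in>J. gain j \<omega> \<in> A} = (\<Prod>j\<in>J. prob (gain j -` A \<inter> space M))"
proof -
  have fin: "finite J" using J by (rule finite_subset) simp
  \<comment> \<open>An empty intersection is the whole type instead of \<open>space M\<close>, so
    \<open>J = {}\<close> is treated separately.\<close>
  have eq: "{\<omega> \<in> space M. \<forall>j\<in>J. gain j \<omega> \<in> A} = (\<Inter>j\<in>J. gain j -` A \<inter> space M)" if "J \<noteq> {}"
    using that by auto
  have "gain j -` A \<inter> space M \<in> events" if "j \<in> J" for j
    using that J by (intro measurable_sets[OF gain_measurable A]) auto
  then show "{\<omega> \<in> space M. \<forall>j\<in>J. gain j \<omega> \<in> A} \<in> events"
    using fin eq sets.finite_INT[of J "\<lambda>j. gain j -` A \<inter> space M" M] by (cases "J = {}") simp_all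
  show "prob {\<omega> \<in> space M. \<forall>j\<in>J. gain j \<omega> \<in> A} = (\<Prod>j\<in>J. prob (gain j -` A \<inter> space M))"
  proof (cases "J = {}")
    case True
    then show ?thesis by (simp add: prob_space)
  next
    case False
    have "indep_vars (\<lambda>_. borel) gain links"
      using iid unfolding iid_rayleigh_gains_def by blast
    then show ?thesis unfolding eq[OF False]
      by (rule indep_varsD) (use False fin J A in auto)
  qed
qed

lemma prob_links_slow_le:
  assumes J: "J \<subseteq> links" and "\<rho> > 0" and "q \<ge> 0"
  shows "{\<omega> \<in> space M. \<forall>j\<in>J. link_rate \<rho> (gain j \<omega>) \<le> q} \<in> events"
    and "prob {\<omega> \<in> space M. \<forall>j\<in>J. link_rate \<rho> (gain j \<omega>) \<le> q} \<le> ((2 powr q - 1) / \<rho>) ^ card J"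
proof -
  define r where "r = sqrt ((2 powr q - 1) / \<rho>)"
  have "(2 powr q - 1) / \<rho> \<ge> 0" using assms by (simp add: ge_one_powr_ge_zero)
  then have r: "r \<ge> 0" "r\<^sup>2 = (2 powr q - 1) / \<rho>" by (simp_all add: r_def)
  note eq = link_rate_le_iff[OF assms(2,3), folded r_def]
  show "{\<omega> \<in> space M. \<forall>j\<in>J. link_rate \<rho> (gain j \<omega>) \<le> q} \<in> events"
    unfolding eq by (rule prob_gains_in(1)[OF J]) simp
  have "prob {\<omega> \<in> space M. \<forall>j\<in>J. link_rate \<rho> (gain j \<omega>) \<le> q} =
      (\<Prod>j\<in>J. prob (gain j -` cball 0 r \<inter> space M))"
    unfolding eq by (rule prob_gains_in(2)[OF J]) simp
  also have "\<dots> \<le> (\<Prod>j\<in>J. r\<^sup>2)"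
    by (intro prod_mono conjI measure_nonneg prob_gain_cball_le subsetD[OF J] r(1))
  finally show "prob {\<omega> \<in> space M. \<forall>j\<in>J. link_rate \<rho> (gain j \<omega>) \<le> q}
      \<le> ((2 powr q - 1) / \<rho>) ^ card J"
    by (simp only: r(2) prod_constant)
qed

text \<open>The condition \<open>2 powr q - 1 \<le> \<rho>\<close> keeps the disk inside the unit
  disk, where the density is bounded below.\<close>

lemma prob_links_slow_ge:
  assumes J: "J \<subseteq> links" and "\<rho> > 0" and "q \<ge> 0" and \<rho>: "2 powr q - 1 \<le> \<rho>"
  shows "(exp (- 1) * ((2 powr q - 1) / \<rho>)) ^ card J
    \<le> prob {\<omega> \<in> space M. \<forall>j\<in>J. link_rate \<rho> (gain j \<omega>) < q}"
proof -
  define r where "r = sqrt ((2 powr q - 1) / \<rho>)"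
  have "(2 powr q - 1) / \<rho> \<ge> 0" using assms by (simp add: ge_one_powr_ge_zero)
  then have r: "r \<ge> 0" "r\<^sup>2 = (2 powr q - 1) / \<rho>" "r \<le> 1"
    using assms by (simp_all add: r_def)
  note eq = link_rate_less_iff[OF assms(2,3), folded r_def]
  have "(exp (- 1) * ((2 powr q - 1) / \<rho>)) ^ card J = (\<Prod>j\<in>J. exp (- 1) * r\<^sup>2)"
    by (simp add: r(2))
  also have "\<dots> \<le> (\<Prod>j\<in>J. prob (gain j -` ball 0 r \<inter> space M))"
    using J prob_gain_ball_ge r(1,3) by (intro prod_mono conjI mult_nonneg_nonneg) auto
  also have "\<dots> = prob {\<omega> \<in> space M. \<forall>j\<in>J. link_rate \<rho> (gain j \<omega>) < q}"
    unfolding eq by (rule prob_gains_in(2)[OF J, symmetric]) simp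
  finally show ?thesis .
qed

end

section \<open>Deterministic analysis of recovery\<close>

text \<open>This admissible point shows that the supremum is over a nonempty set, and it is the test
  point that makes collector links slow in a failure.\<close>

lemma proportional_time_fractions:
  assumes "\<And>i. i \<in> D \<Longrightarrow> a i \<ge> 0" and "sum a D \<ge> 1"
  shows "(\<lambda>i. a i / sum a D) \<in> time_fractions a D"
proof -
  have "a i / sum a D \<le> a i" if "i \<in> D" for i
    using assms that mult_left_mono[of 1 "sum a D" "a i"] by (simp add: divide_le_eq)
  then show ?thesis
    using assms by (auto simp: time_fractions_def sum_divide_distrib[symmetric])
qed

text \<open>The rates achieved form a nonempty set bounded by the value at \<open>t = a\<close>, so
  exceeding \<open>Q\<close> is witnessed by a single choice of time fractions.\<close>

lemma less_max_recovery_rate_iff: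
  assumes fin: "finite D" and a: "\<And>i. i \<in> D \<Longrightarrow> a i \<ge> 0" "sum a D \<ge> 1" and "\<rho> \<ge> 0"
  shows "Q < max_recovery_rate a \<rho> D g
    \<longleftrightarrow> (\<exists>t\<in>time_fractions a D. Q < (\<Sum>i\<in>D. t i * link_rate \<rho> (g i)))"
  unfolding max_recovery_rate_def
proof (rule less_cSUP_iff)
  show "time_fractions a D \<noteq> {}" using proportional_time_fractions[OF a] by blast
  show "bdd_above ((\<lambda>t. \<Sum>i\<in>D. t i * link_rate \<rho> (g i)) ` time_fractions a D)"
    using assms(4)
    by (intro bdd_aboveI2[where M = "\<Sum>i\<in>D. a i * link_rate \<rho> (g i)"])
      (auto simp: time_fractions_def intro!: sum_mono mult_right_mono link_rate_nonneg)
qed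

text \<open>If too little data is decoded, the lost nodes supply the slow source links. Otherwise
  every node with \<open>a i > 0\<close> has a slow link: to the source if it lies outside
  \<open>D\<close>, to the collector if inside. The threshold is a sum so that it dominates every
  \<open>Q * T / a i\<close> at once; terms with \<open>a i = 0\<close> are 0 by the convention for
  division.\<close>

lemma failure_imp_slow_links:
  assumes a: "\<And>i. i \<in> {1..K} \<Longrightarrow> a i \<ge> 0" and T: "sum a {1..K} \<le> T"
    and Q: "Q \<ge> 0" and \<rho>: "\<rho> \<ge> 0"
    and fail: "\<not> recovery_succeeds K Q a \<rho> gs gc"
  shows "\<exists>J\<subseteq>{1..K} <+> {1..K}. card J = loss_exponent K a \<and>
    (\<forall>j\<in>J. link_rate \<rho> (case_sum gs gc j) \<le> Q + (\<Sum>i=1..K. Q * T / a i))"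
proof -
  define q where "q = Q + (\<Sum>i=1..K. Q * T / a i)"
  define D where "D = decoding_set K Q \<rho> gs"
  have D: "D \<subseteq> {1..K}" by (auto simp: D_def decoding_set_def)
  have T0: "T \<ge> 0" using sum_nonneg[of "{1..K}" a] a T by force
  have Qq: "Q \<le> q" unfolding q_def using a Q T0 by (auto intro!: sum_nonneg)
  have slow: "link_rate \<rho> (gs i) \<le> q" if "i \<in> {1..K} - D" for i
    using that Qq by (auto simp: D_def decoding_set_def)
  have "\<exists>J\<subseteq>{1..K} <+> {1..K}. loss_exponent K a \<le> card J \<and>
      (\<forall>j\<in>J. link_rate \<rho> (case_sum gs gc j) \<le> q)"
  proof (cases "sum a D < 1")
    case True
    then have "loss_exponent K a \<le> card ({1..K} - D)"
      using D by (intro loss_exponent_le) (auto simp: double_diff)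
    then show ?thesis using slow
      by (intro exI[of _ "Inl ` ({1..K} - D)"]) (auto simp: card_image)
  next
    case False
    define S where "S = {i \<in> {1..K}. a i > 0}"
    have aD: "\<And>i. i \<in> D \<Longrightarrow> a i \<ge> 0" "sum a D \<ge> 1" using a D False by auto
    have finD: "finite D" using D by (rule finite_subset) simp
    have max: "\<not> Q < max_recovery_rate a \<rho> D gc"
      using fail False unfolding recovery_succeeds_def Let_def D_def[symmetric] by auto
    have "link_rate \<rho> (gc i) \<le> q" if i: "i \<in> S \<inter> D" for i
    proof -
      \<comment> \<open>Under proportional fractions the total rate is at most \<open>Q\<close>, and
        each nonnegative term is at most the total.\<close>
      have "a i / sum a D * link_rate \<rho> (gc i) \<le> (\<Sum>k\<in>D. a k / sum a D * link_rate \<rho> (gc k))"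
        using i aD finD \<rho> by (intro member_le_sum) 
          (auto intro!: mult_nonneg_nonneg divide_nonneg_nonneg link_rate_nonneg
            simp del: times_divide_eq_left)
      also have "\<dots> \<le> Q"
        using less_max_recovery_rate_iff[OF finD aD \<rho>] max proportional_time_fractions[OF aD]
        by (meson not_le)
      finally have "a i * link_rate \<rho> (gc i) \<le> Q * sum a D"
        using aD by (simp add: divide_le_eq)
      \<comment> \<open>This makes the threshold independent of \<open>D\<close> and of
        \<open>\<rho>\<close>.\<close>
      also have "\<dots> \<le> Q * T"
        using sum_mono2[of "{1..K}" D a] D a T Q by (intro mult_left_mono) auto
      finally have "link_rate \<rho> (gc i) \<le> Q * T / a i"
        using i Q by (simp add: S_def le_divide_eq mult.commute)
      also have "\<dots> \<le> (\<Sum>i=1..K. Q * T / a i)"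
        using i a Q T0 by (intro member_le_sum) (auto simp: S_def)
      finally show ?thesis using Q by (simp add: q_def)
    qed
    moreover have "sum a ({1..K} - S) = 0"
    proof (intro sum.neutral ballI)
      fix i assume "i \<in> {1..K} - S"
      then show "a i = 0" using a[of i] by (auto simp: S_def)
    qed
    then have "loss_exponent K a \<le> card S"
      by (intro loss_exponent_le) (auto simp: S_def)
    \<comment> \<open>One slow link is chosen for each node of \<open>S\<close>, so distinct nodes
      give distinct links.\<close>
    moreover have "card (Inl ` (S - D) \<union> Inr ` (S \<inter> D) :: (nat + nat) set) = card S"
    proof -
      have "finite S" by (simp add: S_def)
      then show ?thesis
        using card_Int_Diff[of S D] by (subst card_Un_disjoint) (auto simp: card_image)
    qed
    ultimately show ?thesis using slow
      by (intro exI[of _ "Inl ` (S - D) \<union> Inr ` (S \<inter> D)"]) (auto simp: S_def)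
  qed
  then obtain J where J: "J \<subseteq> {1..K} <+> {1..K}" "loss_exponent K a \<le> card J"
      "\<forall>j\<in>J. link_rate \<rho> (case_sum gs gc j) \<le> q"
    by blast
  \<comment> \<open>Trimming to exactly \<open>loss_exponent K a\<close> links gives all terms of
    the later union bound the same exponent.\<close>
  obtain J' where "J' \<subseteq> J" "card J' = loss_exponent K a"
    using obtain_subset_with_card_n[OF J(2)] by blast
  then show ?thesis using J unfolding q_def by blast
qed

section \<open>Measurability of the failure event\<close>

context rayleigh_gains
begin

lemma decoding_set_event:
  assumes "\<rho> > 0"
  shows "{\<omega> \<in> space M. decoding_set K Q \<rho> (\<lambda>i. hs i \<omega>) = D} \<in> events"
proof (cases "D \<subseteq> {1..K}")
  case True
  have "{\<omega> \<in> space M. decoding_set K Q \<rho> (\<lambda>i. hs i \<omega>) = D} =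
      {\<omega> \<in> space M. \<forall>i\<in>{1..K}. Q \<le> link_rate \<rho> (hs i \<omega>) \<longleftrightarrow> i \<in> D}"
    using True by (auto simp: decoding_set_def)
  also have "\<dots> \<in> events"
  proof (intro sets.sets_Collect_finite_All)
    fix i assume i: "i \<in> {1..K}"
    have [measurable]: "hs i \<in> borel_measurable M" by (rule hs_measurable[OF i])
    have [measurable]: "link_rate \<rho> \<in> borel_measurable borel"
      using assms by (intro borel_measurable_continuous_onI continuous_on_link_rate) auto
    show "{\<omega> \<in> space M. (Q \<le> link_rate \<rho> (hs i \<omega>)) = (i \<in> D)} \<in> events" by measurable
  qed simp
  finally show ?thesis .
next
  case False
  then have "decoding_set K Q \<rho> g \<noteq> D" for g
    by (auto simp: decoding_set_def)
  then show ?thesis by simp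
qed

text \<open>The union over time fractions may be uncountable, but each set in it is open in the
  product topology, so the union is open and hence Borel.\<close>

lemma fast_recovery_event:
  assumes D: "D \<subseteq> {1..K}" and a: "\<And>i. i \<in> D \<Longrightarrow> a i \<ge> 0" "sum a D \<ge> 1" and \<rho>: "\<rho> \<ge> 0"
  shows "{\<omega> \<in> space M. Q < max_recovery_rate a \<rho> D (\<lambda>i. hc i \<omega>)} \<in> events"
proof -
  have fin: "finite D" using D by (rule finite_subset) simp
  define U where "U = (\<Union>t\<in>time_fractions a D.
      {g :: nat \<Rightarrow> complex. Q < (\<Sum>i\<in>D. t i * link_rate \<rho> (g i))})"
  \<comment> \<open>Measurability of \<open>hc i\<close> is known only for \<open>i\<close> in
    \<open>{1..K}\<close>; the other coordinates are set to 0, which does not affect sums over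
    \<open>D\<close>.\<close>
  define X where "X = (\<lambda>\<omega> i. if i \<in> {1..K} then hc i \<omega> else 0)"
  have "open U" unfolding U_def
    by (intro open_UN ballI open_Collect_less continuous_intros continuous_on_link_rate \<rho>
        continuous_on_product_coordinates)
  moreover have "X \<in> borel_measurable M"
  proof (rule measurable_coordinatewise_then_product)
    fix i show "(\<lambda>\<omega>. X \<omega> i) \<in> borel_measurable M"
      by (cases "i \<in> {1..K}") (auto simp: X_def hc_measurable)
  qed
  ultimately have "X -` U \<inter> space M \<in> events" by (intro measurable_sets) auto
  also have "X -` U \<inter> space M = {\<omega> \<in> space M. Q < max_recovery_rate a \<rho> D (\<lambda>i. hc i \<omega>)}"
  proof -
    have "(\<Sum>i\<in>D. t i * link_rate \<rho> (X \<omega> i)) = (\<Sum>i\<in>D. t i * link_rate \<rho> (hc i \<omega>))" for t \<omega>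
      using D by (intro sum.cong) (auto simp: X_def)
    then show ?thesis
      using less_max_recovery_rate_iff[OF fin a \<rho>] by (auto simp: U_def)
  qed
  finally show ?thesis .
qed

text \<open>Success splits over the finitely many possible decoding sets, on each of which
  \<open>D\<close> is constant.\<close>

lemma failure_event:
  assumes a: "\<And>i. i \<in> {1..K} \<Longrightarrow> a i \<ge> 0" and \<rho>: "\<rho> > 0"
  shows "{\<omega> \<in> space M. \<not> recovery_succeeds K Q a \<rho> (\<lambda>i. hs i \<omega>) (\<lambda>i. hc i \<omega>)} \<in> events"
proof -
  have "{\<omega> \<in> space M. recovery_succeeds K Q a \<rho> (\<lambda>i. hs i \<omega>) (\<lambda>i. hc i \<omega>)} =
      (\<Union>D\<in>{D. D \<subseteq> {1..K} \<and> 1 \<le> sum a D}.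
        {\<omega> \<in> space M. decoding_set K Q \<rho> (\<lambda>i. hs i \<omega>) = D} \<inter>
        {\<omega> \<in> space M. Q < max_recovery_rate a \<rho> D (\<lambda>i. hc i \<omega>)})"
    by (auto simp: recovery_succeeds_def Let_def decoding_set_def)
  also have "\<dots> \<in> events"
  proof (intro sets.finite_UN sets.Int)
    show "finite {D. D \<subseteq> {1..K} \<and> 1 \<le> sum a D}" by (rule finite_subset[of _ "Pow {1..K}"]) auto
    fix D assume "D \<in> {D. D \<subseteq> {1..K} \<and> 1 \<le> sum a D}"
    then have D: "D \<subseteq> {1..K}" "1 \<le> sum a D" by auto
    show "{\<omega> \<in> space M. decoding_set K Q \<rho> (\<lambda>i. hs i \<omega>) = D} \<in> events"
      by (rule decoding_set_event[OF \<rho>])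
    show "{\<omega> \<in> space M. Q < max_recovery_rate a \<rho> D (\<lambda>i. hc i \<omega>)} \<in> events"
      using D a \<rho> by (intro fast_recovery_event) auto
  qed
  finally have "space M - {\<omega> \<in> space M. recovery_succeeds K Q a \<rho> (\<lambda>i. hs i \<omega>) (\<lambda>i. hc i \<omega>)} \<in> events"
    by (rule sets.compl_sets)
  also have "space M - {\<omega> \<in> space M. recovery_succeeds K Q a \<rho> (\<lambda>i. hs i \<omega>) (\<lambda>i. hc i \<omega>)} =
      {\<omega> \<in> space M. \<not> recovery_succeeds K Q a \<rho> (\<lambda>i. hs i \<omega>) (\<lambda>i. hc i \<omega>)}" by auto
  finally show ?thesis .
qed


section \<open>Two-sided bounds on the failure probability and its exponent\<close>

text \<open>Failures in the storage phase suffice: slow source links at a smallest fatal set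
  \<open>S\<close> leave less than one unit of data.\<close>

lemma failure_prob_ge:
  assumes a: "\<And>i. i \<in> {1..K} \<Longrightarrow> a i \<ge> 0" and Q: "Q \<ge> 0" and \<rho>: "\<rho> > 0" "2 powr Q - 1 \<le> \<rho>"
  shows "(exp (- 1) * ((2 powr Q - 1) / \<rho>)) ^ loss_exponent K a \<le> failure_prob M hs hc K Q a \<rho>"
proof -
  obtain S where S: "S \<subseteq> {1..K}" "sum a ({1..K} - S) < 1" "card S = loss_exponent K a"
    by (rule loss_exponent_attained)
  let ?J = "Inl ` S :: (nat + nat) set"
  have "(exp (- 1) * ((2 powr Q - 1) / \<rho>)) ^ card ?J
      \<le> prob {\<omega> \<in> space M. \<forall>j\<in>?J. link_rate \<rho> (gain j \<omega>) < Q}"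
    using S(1) Q \<rho> by (intro prob_links_slow_ge) auto
  also have "\<dots> \<le> failure_prob M hs hc K Q a \<rho>"
    unfolding failure_prob_def
  proof (rule finite_measure_mono[OF _ failure_event[OF a \<rho>(1)]])
    have "\<not> recovery_succeeds K Q a \<rho> gs gc" if "\<forall>i\<in>S. link_rate \<rho> (gs i) < Q" for gs gc
    proof -
      have "sum a (decoding_set K Q \<rho> gs) \<le> sum a ({1..K} - S)"
        using that a by (intro sum_mono2) (force simp: decoding_set_def)+
      then show ?thesis using S(2) by (simp add: recovery_succeeds_def Let_def)
    qed
    then show "{\<omega> \<in> space M. \<forall>j\<in>?J. link_rate \<rho> (gain j \<omega>) < Q}
        \<subseteq> {\<omega> \<in> space M. \<not> recovery_succeeds K Q a \<rho> (\<lambda>i. hs i \<omega>) (\<lambda>i. hc i \<omega>)}"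
      by auto
  qed
  finally show ?thesis using S(3) by (simp add: card_image)
qed

text \<open>Union bound over the sets of \<open>loss_exponent K a\<close> links. The number of such
  sets is estimated crudely by that of all sets of links, since constants do not affect the
  exponent.\<close>

lemma failure_prob_le:
  assumes a: "\<And>i. i \<in> {1..K} \<Longrightarrow> a i \<ge> 0" and T: "sum a {1..K} \<le> T"
    and Q: "Q \<ge> 0" and q: "q = Q + (\<Sum>i=1..K. Q * T / a i)" and \<rho>: "\<rho> > 0"
  shows "failure_prob M hs hc K Q a \<rho>
    \<le> real (card (Pow links)) * ((2 powr q - 1) / \<rho>) ^ loss_exponent K a"
proof -
  have "T \<ge> 0" using sum_nonneg[of "{1..K}" a] a T by force
  then have q0: "q \<ge> 0" unfolding q using a Q by (auto intro!: sum_nonneg add_nonneg_nonneg)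
  define F where "F = {J. J \<subseteq> links \<and> card J = loss_exponent K a}"
  define E where "E J = {\<omega> \<in> space M. \<forall>j\<in>J. link_rate \<rho> (gain j \<omega>) \<le> q}" for J
  have F: "F \<subseteq> Pow links" by (auto simp: F_def)
  then have finF: "finite F" by (rule finite_subset) simp
  have E: "E J \<in> events" "prob (E J) \<le> ((2 powr q - 1) / \<rho>) ^ loss_exponent K a" if "J \<in> F" for J
    using prob_links_slow_le[of J \<rho> q] that \<rho> q0 by (auto simp: E_def F_def)
  have "failure_prob M hs hc K Q a \<rho> \<le> prob (\<Union>J\<in>F. E J)"
    unfolding failure_prob_def
  proof (rule finite_measure_mono)
    show "(\<Union>J\<in>F. E J) \<in> events" using E(1) finF by (intro sets.finite_UN) auto
    show "{\<omega> \<in> space M. \<not> recovery_succeeds K Q a \<rho> (\<lambda>i. hs i \<omega>) (\<lambda>i. hc i \<omega>)} \<subseteq> (\<Union>J\<in>F. E J)"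
    proof clarify
      fix \<omega> assume \<omega>: "\<omega> \<in> space M"
        and "\<not> recovery_succeeds K Q a \<rho> (\<lambda>i. hs i \<omega>) (\<lambda>i. hc i \<omega>)"
      then obtain J where J: "J \<in> F"
          "\<forall>j\<in>J. link_rate \<rho> (case_sum (\<lambda>i. hs i \<omega>) (\<lambda>i. hc i \<omega>) j) \<le> q"
        using failure_imp_slow_links[OF a T Q, of \<rho>] \<rho> unfolding F_def q by force
      have "case_sum (\<lambda>i. hs i \<omega>) (\<lambda>i. hc i \<omega>) j = gain j \<omega>" for j
        by (cases j) auto
      then show "\<omega> \<in> (\<Union>J\<in>F. E J)" using J \<omega> by (auto simp: E_def)
    qed
  qed
  also have "\<dots> \<le> (\<Sum>J\<in>F. prob (E J))"
    using E(1) finF by (intro finite_measure_subadditive_finite) auto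
  also have "\<dots> \<le> real (card F) * ((2 powr q - 1) / \<rho>) ^ loss_exponent K a"
    using E(2) by (intro sum_bounded_above)
  also have "\<dots> \<le> real (card (Pow links)) * ((2 powr q - 1) / \<rho>) ^ loss_exponent K a"
    using F \<rho> q0 by (intro mult_right_mono of_nat_mono card_mono) (auto simp: ge_one_powr_ge_zero)
  finally show ?thesis .
qed

lemma failure_prob_exponent:
  assumes a: "a \<in> storage_allocations K T" and Q: "Q > 0"
  shows "((\<lambda>\<rho>. ln (failure_prob M hs hc K Q a \<rho>) / ln \<rho>) \<longlongrightarrow> - real (loss_exponent K a)) at_top"
proof -
  have a: "\<And>i. i \<in> {1..K} \<Longrightarrow> a i \<ge> 0" and T: "sum a {1..K} \<le> T"
    using a by (auto simp: storage_allocations_def)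
  let ?d = "loss_exponent K a"
  define q where "q = Q + (\<Sum>i=1..K. Q * T / a i)"
  have "T \<ge> 0" using sum_nonneg[of "{1..K}" a] a T by force
  then have "(\<Sum>i=1..K. Q * T / a i) \<ge> 0" using a Q by (auto intro!: sum_nonneg)
  then have q: "2 powr q - 1 > 0" using Q by (simp add: q_def)
  \<comment> \<open>Strict positivity of \<open>Q\<close> keeps the constant of the lower bound
    positive.\<close>
  have Q': "2 powr Q - 1 > 0" using Q by simp
  show ?thesis
  proof (rule tendsto_ln_ratio_powr_bounds)
    show "(exp (- 1) * (2 powr Q - 1)) ^ ?d > 0" using Q' by simp
    show "real (card (Pow links)) * (2 powr q - 1) ^ ?d > 0"
      using q by (simp add: card_Pow)
    show "\<forall>\<^sub>F \<rho> in at_top. (exp (- 1) * (2 powr Q - 1)) ^ ?d * (1 / \<rho>) ^ ?d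
        \<le> failure_prob M hs hc K Q a \<rho>"
      using eventually_gt_at_top[of 0] eventually_ge_at_top[of "2 powr Q - 1"]
    proof eventually_elim
      case (elim \<rho>)
      then show ?case
        using failure_prob_ge[where a = a and Q = Q and \<rho> = \<rho>] a Q by (simp add: power_mult_distrib power_divide)
    qed
    show "\<forall>\<^sub>F \<rho> in at_top. failure_prob M hs hc K Q a \<rho>
        \<le> real (card (Pow links)) * (2 powr q - 1) ^ ?d * (1 / \<rho>) ^ ?d"
      using eventually_gt_at_top[of 0]
    proof eventually_elim
      case (elim \<rho>)
      then show ?case
        using failure_prob_le[OF a T _ q_def elim] Q by (simp add: power_divide)
    qed
  qed
qed

text \<open>Since the limit exists, \<open>Lim\<close> returns it; comparing orders becomes
  comparing natural numbers.\<close>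

lemma failure_order_eq:
  assumes "a \<in> storage_allocations K T" and "Q > 0"
  shows "failure_order M hs hc K Q a = real (loss_exponent K a)"
  unfolding failure_order_def
  using tendsto_Lim[OF _ failure_prob_exponent[OF assms]] by simp

end

theorem theorem1:
  fixes M :: "'w measure" and hs hc :: "nat \<Rightarrow> 'w \<Rightarrow> complex"
    and K :: nat and Q T :: real
  assumes "prob_space M"
    and "iid_rayleigh_gains M K hs hc"
    and "K \<ge> 1" and "Q > 0" and "T > 1"
  shows "max_symmetric_allocation K T \<in> storage_allocations K T \<and>
    (\<forall>a \<in> storage_allocations K T.
       ((\<lambda>\<rho>. ln (failure_prob M hs hc K Q a \<rho>) / ln \<rho>) \<longlongrightarrow> - failure_order M hs hc K Q a) at_top \<and>
       failure_order M hs hc K Q a \<le> failure_order M hs hc K Q (max_symmetric_allocation K T))"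
proof -
  interpret rayleigh_gains M K hs hc
    using assms(1,2) by (simp add: rayleigh_gains_def rayleigh_gains_axioms_def)
  have sym: "max_symmetric_allocation K T \<in> storage_allocations K T"
    using assms by (intro max_symmetric_allocation_in) auto
  then show ?thesis
    using failure_prob_exponent failure_order_eq loss_exponent_le_symmetric assms(3,4) by simp
qed

end
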